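(* Let $K=\mathbb{F}_q$ be a finite field with $q$ elements, let $s\geq 1$, and let $$X=\{[(x_1,\ldots,x_s)]\in\mathbb{P}^{s-1}\mid x_i\in K^*\text{ for all }i\}$$ be the projective torus in the projective space $\mathbb{P}^{s-1}$ over $K$. Let $d\geq 1$ be an integer. Then the minimum distance $\delta_d$ of the code $C_X(d)$ is given by $$ \delta_d=\begin{cases} (q-1)^{s-(k+2)}(q-1-\ell) & \text{if } d\leq (q-2)(s-1)-1,\\ 1 & \text{if } d\geq (q-2)(s-1), \end{cases} $$ where, in the first case, $k$ and $\ell$ are the unique integers such that $k\geq 0$, $1\leq \ell\leq q-2$ and $d=k(q-2)+\ell$.
   Context: $K^*=K\setminus\{0\}$, and $\mathbb{P}^{s-1}=(K^s\setminus\{0\})/\sim$ where $\alpha\sim\beta$ iff $\alpha=\lambda\beta$ for some $\lambda\in K^*$; $[\alpha]$ denotes the class of $\alpha$. Let $S=K[t_1,\ldots,t_s]=\bigoplus_{d\ge 0}S_d$ with the standard grading. Let $[P_1],\ldots,[P_m]$ be the points of $X$ ($m=|X|$) and let $f_0=t_1^d$. The evaluation map is the $K$-linear map $$\mathrm{ev}_d\colon S_d\to K^{|X|},\qquad f\mapsto\left(\frac{f(P_1)}{f_0(P_1)},\ldots,\frac{f(P_m)}{f_0(P_m)}\right),$$ which is independent of the choice of representatives $P_i$. The code $C_X(d)$ is the image of $\mathrm{ev}_d$, a linear subspace of $K^{|X|}$. Its minimum distance is $\delta_d=\min\{\|v\| : 0\neq v\in C_X(d)\}$, where $\|v\|$ is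 the number of non-zero entries of $v$. *)

theory Defs
  imports Complex_Main "HOL-Library.Poly_Mapping" "HOL-Library.Cardinality"
    "Jordan_Normal_Form.Matrix"
begin

text \<open>The space $K^s$ is \<open>carrier_vec s\<close>; coordinates and variables are indexed from 0, so
  $t_1$ is the variable with index 0.\<close>

definition proj_rel :: "nat \<Rightarrow> ('a :: field vec \<times> 'a vec) set" where
  "proj_rel s = {(\<alpha>, \<beta>). \<alpha> \<in> carrier_vec s - {0\<^sub>v s} \<and> \<beta> \<in> carrier_vec s - {0\<^sub>v s} \<and>
     (\<exists>c. c \<noteq> 0 \<and> \<alpha> = c \<cdot>\<^sub>v \<beta>)}"

lemma equiv_proj_rel:
  fixes s :: nat and R :: "('a :: field vec \<times> 'a vec) set" and V :: "'a vec set"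
  defines "R \<equiv> proj_rel s" and "V \<equiv> carrier_vec s - {0\<^sub>v s}"
  shows "equiv V R"
proof (rule equivI)
  show "R \<subseteq> V \<times> V"
    by (auto simp: R_def V_def proj_rel_def)
  show "refl_on V R"
    by (auto simp: refl_on_def R_def V_def proj_rel_def intro!: exI[of _ 1])
  show "sym R"
  proof (rule symI)
    fix x y :: "'a vec" assume "(x, y) \<in> R"
    then obtain c where c: "c \<noteq> 0" "x = c \<cdot>\<^sub>v y" "x \<in> V"
      "y \<in> V"
      by (auto simp: R_def V_def proj_rel_def)
    moreover have "y = inverse c \<cdot>\<^sub>v x"
      using c by (simp add: smult_smult_assoc)
    ultimately show "(y, x) \<in> R"
      unfolding R_def V_def proj_rel_def using nonzero_imp_inverse_nonzero[OF c(1)] by blast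
  qed
  show "trans R"
  proof (rule transI)
    fix x y z :: "'a vec" assume "(x, y) \<in> R" "(y, z) \<in> R"
    then obtain c c' where c: "c \<noteq> 0" "x = c \<cdot>\<^sub>v y" "c' \<noteq> 0" "y = c' \<cdot>\<^sub>v z"
      "x \<in> V" "z \<in> V"
      by (auto simp: R_def V_def proj_rel_def)
    moreover have "x = (c * c') \<cdot>\<^sub>v z" "c * c' \<noteq> 0"
      using c by (simp_all add: smult_smult_assoc)
    ultimately show "(x, z) \<in> R"
      unfolding R_def V_def proj_rel_def by blast
  qed
qed

definition proj_space :: "nat \<Rightarrow> 'a :: field vec set set" where
  "proj_space s = (carrier_vec s - {0\<^sub>v s}) // proj_rel s"

definition proj_class :: "nat \<Rightarrow> 'a :: field vec \<Rightarrow> 'a vec set" where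
  "proj_class s \<alpha> = proj_rel s `` {\<alpha>}"

definition proj_torus :: "nat \<Rightarrow> 'a :: field vec set set" where
  "proj_torus s = {c \<in> proj_space s. \<exists>x \<in> carrier_vec s. (\<forall>i < s. x $ i \<noteq> 0) \<and> c = proj_class s x}"

text \<open>A list of representatives $P_1,\dots,P_m$, one for each point of \<open>X\<close>, in some order.\<close>

definition representatives :: "nat \<Rightarrow> 'a :: field vec set set \<Rightarrow> 'a vec list \<Rightarrow> bool" where
  "representatives s X ps \<longleftrightarrow> set ps \<subseteq> carrier_vec s - {0\<^sub>v s} \<and>
     distinct (map (proj_class s) ps) \<and> set (map (proj_class s) ps) = X"

text \<open>Polynomials in the variables $t_i$ are finitely supported maps from exponent vectors to
  coefficients.  The ring $S$ uses only the variables with index below \<open>s\<close>.\<close>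

type_synonym 'a mpolynomial = "(nat \<Rightarrow>\<^sub>0 nat) \<Rightarrow>\<^sub>0 'a"

definition homogeneous_part :: "nat \<Rightarrow> nat \<Rightarrow> 'a :: field mpolynomial set" where
  "homogeneous_part s d = {f. \<forall>m \<in> Poly_Mapping.keys f. Poly_Mapping.keys m \<subseteq> {..<s} \<and>
     (\<Sum>i \<in> Poly_Mapping.keys m. Poly_Mapping.lookup m i) = d}"

definition eval_poly_at :: "'a :: field mpolynomial \<Rightarrow> 'a vec \<Rightarrow> 'a" where
  "eval_poly_at f x = (\<Sum>m \<in> Poly_Mapping.keys f. Poly_Mapping.lookup f m *
     (\<Prod>i \<in> Poly_Mapping.keys m. (x $ i) ^ Poly_Mapping.lookup m i))"

definition poly_var :: "nat \<Rightarrow> 'a :: field mpolynomial" where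
  "poly_var i = Poly_Mapping.single (Poly_Mapping.single i 1) 1"

definition ev :: "nat \<Rightarrow> 'a :: field vec list \<Rightarrow> 'a mpolynomial \<Rightarrow> 'a vec" where
  "ev d ps f = vec_of_list (map (\<lambda>p. eval_poly_at f p / eval_poly_at (poly_var 0 ^ d) p) ps)"

definition eval_code :: "nat \<Rightarrow> nat \<Rightarrow> 'a :: field vec list \<Rightarrow> 'a vec set" where
  "eval_code s d ps = ev d ps ` homogeneous_part s d"

definition hamming_weight :: "'a :: zero vec \<Rightarrow> nat" where
  "hamming_weight v = card {i. i < dim_vec v \<and> v $ i \<noteq> 0}"

definition min_distance :: "nat \<Rightarrow> 'a :: zero vec set \<Rightarrow> nat" where
  "min_distance n C = Min (hamming_weight ` (C - {0\<^sub>v n}))"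

end

theory Submission
  imports Defs "HOL-Computational_Algebra.Polynomial"
begin

text \<open>
  Write \<open>s = n + 1\<close>.  Scaling a representative so that its first coordinate is \<open>1\<close> identifies the
  projective torus with the affine torus \<open>(K\<^sup>*)\<^sup>n\<close>, and then \<open>f / t\<^sub>1\<^sup>d\<close> becomes the dehomogenization
  of \<open>f\<close>, a polynomial in \<open>n\<close> variables of degree at most \<open>d\<close>.  The weight of a codeword is therefore
  the number of nonzeros of such a polynomial on \<open>(K\<^sup>*)\<^sup>n\<close>, and the claim is that this number, when it
  is positive, is smallest for the obvious products of linear factors.

  Nonzeros are bounded below variable by variable.  Since \<open>a\<^bsup>q-1\<^esup> = 1\<close> for \<open>a \<in> K\<^sup>*\<close>, exponents of the
  last variable can be reduced below \<open>q - 1\<close>; if \<open>t\<close> is the largest power whose coefficient does not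
  vanish identically on the torus, then over each nonzero of that coefficient at most \<open>t\<close> values of
  the last variable are roots, and the coefficient has degree at most \<open>d - t\<close>.  Iterating, the number
  of nonzeros is at least \<open>\<Prod>\<^sub>i (q - 1 - r\<^sub>i)\<close> for some \<open>r\<^sub>i \<le> q - 2\<close> with \<open>\<Sum>\<^sub>i r\<^sub>i \<le> d\<close>
  (\<open>card_torus_nonzeros_ge\<close>).  Conversely every such product is the weight of a codeword: multiply
  \<open>r\<^sub>i\<close> distinct factors \<open>t\<^bsub>i+1\<^esub> - a t\<^sub>1\<close> with \<open>a \<in> K\<^sup>*\<close> for each \<open>i = 1, \<dots>, n\<close>, and fill up the degree with a power of \<open>t\<^sub>1\<close>, which
  vanishes nowhere (\<open>exists_form_with_weight\<close>).

  What remains is to minimize the product under the constraint on the sum.  It is smallest when the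
  \<open>r\<^sub>i\<close> are as unequal as possible: \<open>k\<close> of them equal to \<open>q - 2\<close>, one equal to \<open>\<ell>\<close> and the others \<open>0\<close>,
  where \<open>d = k (q - 2) + \<ell>\<close> (\<open>prod_gap_ge\<close>).  If \<open>d \<ge> n (q - 2)\<close>, all of them can be \<open>q - 2\<close>, and the
  product is \<open>1\<close>.
\<close>

section \<open>Univariate polynomial functions on the units of a finite field\<close>

lemma card_units: "card (- {0 :: 'a :: {zero, finite}}) = CARD('a) - 1"
  by (simp add: Compl_eq_Diff_UNIV card_Diff_subset)

lemma unit_power_card_units:
  fixes a :: "'a :: {field, finite}"
  assumes "a \<noteq> 0"
  shows "a ^ (CARD('a) - 1) = 1"
proof -
  have "a ^ (CARD('a) - 1) * \<Prod>(- {0}) = (\<Prod>y\<in>- {0}. a * y)"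
    by (simp add: prod.distrib card_units)
  also have "\<dots> = (\<Prod>y\<in>- {0}. y)"
    by (rule prod.reindex_bij_witness[of _ "\<lambda>y. y / a" "\<lambda>y. a * y"]) (use assms in auto)
  finally show ?thesis by simp
qed

text \<open>On units, only exponents modulo \<open>q - 1\<close> matter.  This is what bounds the degree in a single
  variable by \<open>q - 2\<close>.\<close>

lemma unit_power_mod:
  fixes a :: "'a :: {field, finite}"
  assumes "a \<noteq> 0"
  shows "a ^ (j mod (CARD('a) - 1)) = a ^ j"
proof -
  have "a ^ j = a ^ ((CARD('a) - 1) * (j div (CARD('a) - 1)) + j mod (CARD('a) - 1))"
    by simp
  also have "\<dots> = a ^ (j mod (CARD('a) - 1))"
    by (simp only: power_add power_mult unit_power_card_units[OF assms]) simp
  finally show ?thesis ..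
qed

lemma card_roots_le_top_index:
  fixes c :: "nat \<Rightarrow> 'a :: field"
  assumes "c r \<noteq> 0"
  shows "card {a. (\<Sum>j\<le>r. c j * a ^ j) = 0} \<le> r"
proof -
  define p where "p = (\<Sum>j\<le>r. monom (c j) j)"
  have "coeff p r = c r"
    by (simp add: p_def coeff_sum sum.delta)
  then have "p \<noteq> 0" using assms by auto
  moreover have "degree p \<le> r"
    unfolding p_def by (intro degree_sum_le) (auto intro: order_trans[OF degree_monom_le])
  moreover have "poly p a = (\<Sum>j\<le>r. c j * a ^ j)" for a
    by (simp add: p_def poly_sum poly_monom)
  ultimately show ?thesis
    using card_poly_roots_bound[of p] by simp
qed

lemma card_unit_nonroots_ge:
  fixes c :: "nat \<Rightarrow> 'a :: {field, finite}"
  assumes "c r \<noteq> 0"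
  shows "CARD('a) - 1 - r \<le> card {a \<in> - {0}. (\<Sum>j\<le>r. c j * a ^ j) \<noteq> 0}"
proof -
  have "{a \<in> - {0}. (\<Sum>j\<le>r. c j * a ^ j) \<noteq> 0} = - {0} - {a. (\<Sum>j\<le>r. c j * a ^ j) = 0}"
    by auto
  then show ?thesis
    using card_roots_le_top_index[of c r] assms card_units[where ?'a = 'a]
      diff_card_le_card_Diff[of "{a. (\<Sum>j\<le>r. c j * a ^ j) = 0}" "- {0}"] by force
qed

section \<open>Nonzeros of polynomials on the affine torus\<close>

text \<open>The points are extensional functions on \<open>{..<n}\<close>, so that a point of the torus in \<open>n + 1\<close>
  dimensions is uniquely of the form \<open>x(n := a)\<close> with \<open>x\<close> in the torus in \<open>n\<close> dimensions.\<close>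

definition affine_torus :: "nat \<Rightarrow> (nat \<Rightarrow> 'a :: zero) set" where
  "affine_torus n = (\<Pi>\<^sub>E i\<in>{..<n}. - {0})"

lemma affine_torus_Suc_upd:
  "x \<in> affine_torus n \<Longrightarrow> a \<noteq> 0 \<Longrightarrow> x(n := a) \<in> affine_torus (Suc n)"
  unfolding affine_torus_def lessThan_Suc by (rule PiE_fun_upd) auto

lemma affine_torus_SucE:
  assumes "y \<in> affine_torus (Suc n)"
  obtains x a where "x \<in> affine_torus n" "a \<noteq> 0" "y = x(n := a)"
  using assms unfolding affine_torus_def lessThan_Suc PiE_insert_eq by auto

lemma finite_affine_torus [simp]: "finite (affine_torus n :: (nat \<Rightarrow> 'a :: {zero, finite}) set)"
  unfolding affine_torus_def by (intro finite_PiE) auto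

text \<open>This bound in the style of Alon and Fueredi is proved by splitting off the last variable.
  The polynomial is given as a family of monomials over an arbitrary index set, in which exponent
  vectors may repeat and may have nonzero entries beyond \<open>n\<close>; hence the coefficient of a power of the
  last variable is the same sum over a smaller index set, and the induction hypothesis applies to it
  directly.\<close>

lemma card_torus_nonzeros_ge:
  fixes c :: "'b \<Rightarrow> 'a :: {field, finite}" and e :: "'b \<Rightarrow> nat \<Rightarrow> nat" and E :: "'b set"
  defines "F \<equiv> \<lambda>n E x. \<Sum>m\<in>E. c m * (\<Prod>i<n. x i ^ e m i)"
  assumes "finite E"
    and "\<And>m. m \<in> E \<Longrightarrow> (\<Sum>i<n. e m i) \<le> d"
    and "\<exists>x \<in> affine_torus n. F n E x \<noteq> 0"
  shows "\<exists>r. (\<forall>i<n. r i < CARD('a) - 1) \<and> (\<Sum>i<n. r i) \<le> d \<and>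
    (\<Prod>i<n. CARD('a) - 1 - r i) \<le> card {x \<in> affine_torus n. F n E x \<noteq> 0}"
  using assms(2-)
proof (induction n arbitrary: E d)
  case 0
  then have "{x \<in> affine_torus 0. F 0 E x \<noteq> 0} \<noteq> {}" by blast
  then have "0 < card {x \<in> affine_torus 0. F 0 E x \<noteq> 0}"
    by (subst card_gt_0_iff) simp
  then show ?case by simp
next
  case (Suc n)
  let ?q = "CARD('a) - 1"
  have q: "0 < ?q"
    using card_mono[of UNIV "{0, 1 :: 'a}"] by simp
  (* F n (E' r) is the coefficient of the r-th power of the last variable after reducing exponents. *)
  define E' where "E' r = {m \<in> E. e m n mod ?q = r}" for r
  have fin: "finite (E' r)" for r using Suc.prems(1) by (simp add: E'_def)
  have split: "F (Suc n) E (x(n := a)) = (\<Sum>r<?q. F n (E' r) x * a ^ r)"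
    if "a \<noteq> 0" for x a
  proof -
    have "F (Suc n) E (x(n := a)) = (\<Sum>m\<in>E. c m * (\<Prod>i<n. x i ^ e m i) * a ^ e m n)"
      by (simp add: F_def mult.assoc)
    also have "\<dots> = (\<Sum>m\<in>E. c m * (\<Prod>i<n. x i ^ e m i) * a ^ (e m n mod ?q))"
      by (simp only: unit_power_mod[OF that])
    also have "\<dots> = (\<Sum>r<?q. \<Sum>m\<in>E' r. c m * (\<Prod>i<n. x i ^ e m i) * a ^ (e m n mod ?q))"
      unfolding E'_def using Suc.prems(1) q by (intro sum.group[symmetric]) auto
    also have "\<dots> = (\<Sum>r<?q. F n (E' r) x * a ^ r)"
      unfolding F_def sum_distrib_right by (intro sum.cong) (simp_all add: E'_def)
    finally show ?thesis .
  qed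
  (* The leading coefficient is the last one that does not vanish as a function on the torus;
     higher ones may be nonzero as polynomials but contribute nothing. *)
  define R where "R = {r. r < ?q \<and> (\<exists>x \<in> affine_torus n. F n (E' r) x \<noteq> 0)}"
  have "R \<noteq> {}"
  proof -
    obtain x a where "x \<in> affine_torus n" "a \<noteq> 0" "F (Suc n) E (x(n := a)) \<noteq> 0"
      using Suc.prems(3) by (auto elim!: affine_torus_SucE)
    then have "(\<Sum>r<?q. F n (E' r) x * a ^ r) \<noteq> 0" by (simp add: split)
    then obtain r where "r < ?q" "F n (E' r) x \<noteq> 0"
      by (rule sum.not_neutral_contains_not_neutral) auto
    with \<open>x \<in> affine_torus n\<close> show ?thesis unfolding R_def by auto
  qed
  have finR: "finite R" by (simp add: R_def)
  define t where "t = Max R"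
  have "t \<in> R" unfolding t_def using finR \<open>R \<noteq> {}\<close> by (rule Max_in)
  then have t: "t < ?q" "\<exists>x \<in> affine_torus n. F n (E' t) x \<noteq> 0" by (auto simp: R_def)
  have above: "F n (E' r) x = 0" if "t < r" "r < ?q" "x \<in> affine_torus n" for r x
  proof -
    have "r \<notin> R" using Max_ge[OF finR, of r] that(1) unfolding t_def by (auto simp: not_less)
    then show ?thesis using that(2,3) unfolding R_def by blast
  qed
  have split': "F (Suc n) E (x(n := a)) = (\<Sum>r\<le>t. F n (E' r) x * a ^ r)"
    if "a \<noteq> 0" "x \<in> affine_torus n" for x a
    unfolding split[OF that(1)] using t(1) that(2) by (intro sum.mono_neutral_right) (auto simp: above)
  have deg: "(\<Sum>i<n. e m i) \<le> d - t" and td: "t \<le> d" if "m \<in> E' t" for m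
  proof -
    have "t \<le> e m n" using that mod_less_eq_dividend[of "e m n" ?q] by (auto simp: E'_def)
    moreover have "(\<Sum>i<n. e m i) + e m n \<le> d" using Suc.prems(2)[of m] that by (simp add: E'_def)
    ultimately show "(\<Sum>i<n. e m i) \<le> d - t" "t \<le> d" by simp_all
  qed
  have "E' t \<noteq> {}" using t(2) by (auto simp: F_def)
  with td have td: "t \<le> d" by auto
  obtain r where r: "\<forall>i<n. r i < ?q" "(\<Sum>i<n. r i) \<le> d - t"
    "(\<Prod>i<n. ?q - r i) \<le> card {x \<in> affine_torus n. F n (E' t) x \<noteq> 0}"
    using Suc.IH[OF fin[of t] deg t(2)] by blast
  (* The base points where the leading coefficient survives, and the nonroots in the fibre over each. *)
  define A where "A = {x \<in> affine_torus n. F n (E' t) x \<noteq> 0}"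
  define B where "B x = {a \<in> - {0}. (\<Sum>r\<le>t. F n (E' r) x * a ^ r) \<noteq> 0}" for x
  define h where "h = (\<lambda>(x :: nat \<Rightarrow> 'a, a). x(n := a))"
  have inj: "inj_on h (Sigma A B)"
  proof (rule inj_onI, clarify)
    fix x a y b assume *: "x \<in> A" "y \<in> A" "h (x, a) = h (y, b)"
    have "x n = undefined" "y n = undefined"
      using *(1,2) by (auto simp: A_def affine_torus_def PiE_def extensional_def)
    then show "x = y \<and> a = b"
      using *(3) unfolding h_def by (metis case_prod_conv fun_upd_same fun_upd_triv fun_upd_upd)
  qed
  have sub: "h ` Sigma A B \<subseteq> {x \<in> affine_torus (Suc n). F (Suc n) E x \<noteq> 0}"
    by (auto simp: h_def A_def B_def split' affine_torus_Suc_upd)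
  have finA: "finite A" by (simp add: A_def)
  have "(\<Prod>i<Suc n. ?q - (r(n := t)) i) = (\<Prod>i<n. ?q - r i) * (?q - t)" by simp
  also have "\<dots> \<le> card A * (?q - t)"
    using r(3) unfolding A_def by (rule mult_right_mono) simp
  also have "\<dots> = (\<Sum>x\<in>A. ?q - t)" by simp
  also have "\<dots> \<le> (\<Sum>x\<in>A. card (B x))"
    unfolding B_def by (intro sum_mono card_unit_nonroots_ge) (simp add: A_def)
  also have "\<dots> = card (h ` Sigma A B)"
    by (simp add: card_image[OF inj] card_SigmaI finA)
  also have "\<dots> \<le> card {x \<in> affine_torus (Suc n). F (Suc n) E x \<noteq> 0}"
    using sub by (intro card_mono) auto
  finally show ?case
    using r(1,2) t(1) td by (intro exI[of _ "r(n := t)"]) (auto simp: less_Suc_eq)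
qed

text \<open>Here \<open>M\<close> stands for \<open>q - 2\<close>.  Replacing \<open>r\<^sub>i \<le> r\<^sub>j\<close> by \<open>r\<^sub>i - 1\<close> and \<open>r\<^sub>j + 1\<close> decreases the product of the two gaps, so the
  minimum is at the most unequal \<open>r\<close>.  In the induction this exchange takes place between the last
  entry \<open>r\<^sub>n\<close> and the remainder \<open>l\<close>: either \<open>r\<^sub>n\<close> is taken out of \<open>l\<close>, or one of the \<open>k\<close> blocks
  of size \<open>M\<close> has to be broken up.\<close>

lemma prod_gap_ge:
  fixes r :: "nat \<Rightarrow> nat" and M :: nat
  assumes "\<And>i. i < n \<Longrightarrow> r i \<le> M"
    and "(\<Sum>i<n. r i) \<le> k * M + l" and "l \<le> M" and "k < n"
  shows "(M + 1) ^ (n - 1 - k) * (M + 1 - l) \<le> (\<Prod>i<n. M + 1 - r i)"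
  using assms
proof (induction n arbitrary: k l)
  case 0
  then show ?case by simp
next
  case (Suc n)
  let ?P = "\<Prod>i<n. M + 1 - r i"
  have rM: "r n \<le> M" using Suc.prems(1) by simp
  have sum: "(\<Sum>i<n. r i) + r n \<le> k * M + l" using Suc.prems(2) by simp
  have goal: "?case" if "(M + 1) ^ (n - k) * (M + 1 - l) \<le> ?P * (M + 1 - r n)"
    using that by simp
  show ?case
  proof (rule goal, cases "r n \<le> l")
    case True
    show "(M + 1) ^ (n - k) * (M + 1 - l) \<le> ?P * (M + 1 - r n)"
    proof (cases "k < n")
      case k: True
      have IH: "(M + 1) ^ (n - 1 - k) * (M + 1 - (l - r n)) \<le> ?P"
        using Suc.IH[of k "l - r n"] Suc.prems(1,3) sum True k by simp
      obtain x where x: "l = r n + x" using True le_Suc_ex by blast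
      obtain y where y: "M = l + y" using Suc.prems(3) le_Suc_ex by blast
      (* The difference of the two sides is x * r n. *)
      have "(M + 1) * (M + 1 - l) \<le> (M + 1 - (l - r n)) * (M + 1 - r n)"
        by (simp add: y x algebra_simps)
      then have "(M + 1) ^ (n - 1 - k) * ((M + 1) * (M + 1 - l))
          \<le> (M + 1) ^ (n - 1 - k) * ((M + 1 - (l - r n)) * (M + 1 - r n))"
        by (rule mult_left_mono) simp
      also have "\<dots> \<le> ?P * (M + 1 - r n)"
        using IH by (metis mult.assoc mult_right_mono zero_le)
      finally show ?thesis
        using k by (metis Suc_diff_Suc diff_Suc_eq_diff_pred mult.assoc mult.commute power_Suc)
    next
      case False
      have "1 \<le> ?P" using Suc.prems(1) by (intro prod_ge_1) (simp add: Suc_le_eq less_Suc_eq_le)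
      then have "M + 1 - l \<le> ?P * (M + 1 - r n)" 
        using mult_le_mono[of 1 ?P "M + 1 - l" "M + 1 - r n"] True by simp
      then show ?thesis using False Suc.prems(4) by simp
    qed
  next
    case False
    then obtain k' where k': "k = Suc k'" using sum by (cases k) auto
    have IH: "(M + 1) ^ (n - 1 - k') * (M + 1 - (M + l - r n)) \<le> ?P"
      by (rule Suc.IH) (use Suc.prems(1,4) sum rM False k' in simp_all)
    obtain x where x: "r n = l + Suc x" using False by (metis less_imp_Suc_add not_le add_Suc_right)
    obtain y where y: "M = r n + y" using rM le_Suc_ex by blast
    (* An instance of a + b - 1 \<le> a * b for positive a and b. *)
    have "M + 1 - l \<le> (M + 1 - (M + l - r n)) * (M + 1 - r n)"
      by (simp add: x y)
    then have "(M + 1) ^ (n - k) * (M + 1 - l)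
        \<le> (M + 1) ^ (n - k) * ((M + 1 - (M + l - r n)) * (M + 1 - r n))"
      by (rule mult_left_mono) simp
    also have "\<dots> \<le> ?P * (M + 1 - r n)"
      unfolding mult.assoc[symmetric] using IH by (intro mult_right_mono) (simp_all only: k' diff_diff_left plus_1_eq_Suc)
    finally show "(M + 1) ^ (n - k) * (M + 1 - l) \<le> ?P * (M + 1 - r n)" .
  qed
qed


section \<open>Homogeneous polynomials and their values\<close>

lemma eval_monomial_add:
  fixes x :: "'a :: field vec" and m m' :: "nat \<Rightarrow>\<^sub>0 nat"
  shows "(\<Prod>i\<in>Poly_Mapping.keys (m + m'). (x $ i) ^ Poly_Mapping.lookup (m + m') i) =
    (\<Prod>i\<in>Poly_Mapping.keys m. (x $ i) ^ Poly_Mapping.lookup m i) *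
    (\<Prod>i\<in>Poly_Mapping.keys m'. (x $ i) ^ Poly_Mapping.lookup m' i)"
proof -
  let ?A = "Poly_Mapping.keys m \<union> Poly_Mapping.keys m'"
  have *: "(\<Prod>i\<in>Poly_Mapping.keys k. (x $ i) ^ Poly_Mapping.lookup k i) =
      (\<Prod>i\<in>?A. (x $ i) ^ Poly_Mapping.lookup k i)"
    if "Poly_Mapping.keys k \<subseteq> ?A" for k
    using that by (intro prod.mono_neutral_left) (auto simp: in_keys_iff)
  show ?thesis
    using *[of m] *[of m'] *[of "m + m'"] Poly_Mapping.keys_add[of m m']
    by (simp add: lookup_add power_add prod.distrib)
qed

lemma eval_poly_at_zero [simp]: "eval_poly_at 0 x = 0"
  by (simp add: eval_poly_at_def)

lemma eval_poly_at_add: "eval_poly_at (f + g) x = eval_poly_at f x + eval_poly_at g x"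
  unfolding eval_poly_at_def
  by (rule setsum_keys_plus_distrib[where f = "\<lambda>m a. a * (\<Prod>i\<in>Poly_Mapping.keys m. (x $ i) ^ Poly_Mapping.lookup m i)"])
    (simp_all add: distrib_right)

lemma eval_poly_at_sum: "eval_poly_at (sum f A) x = (\<Sum>i\<in>A. eval_poly_at (f i) x)"
  by (induction A rule: infinite_finite_induct) (simp_all add: eval_poly_at_add)

lemma eval_poly_at_single:
  "eval_poly_at (Poly_Mapping.single m a) x =
    a * (\<Prod>i\<in>Poly_Mapping.keys m. (x $ i) ^ Poly_Mapping.lookup m i)"
  by (simp add: eval_poly_at_def)

lemma poly_mapping_eq_sum_single:
  "f = (\<Sum>m\<in>Poly_Mapping.keys f. Poly_Mapping.single m (Poly_Mapping.lookup f m))"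
  by (rule poly_mapping_eqI) (simp add: lookup_sum lookup_single when_def in_keys_iff)

lemma eval_poly_at_mult: "eval_poly_at (f * g) x = eval_poly_at f x * eval_poly_at g x"
proof -
  have "f * g = (\<Sum>m\<in>Poly_Mapping.keys f. \<Sum>k\<in>Poly_Mapping.keys g.
      Poly_Mapping.single (m + k) (Poly_Mapping.lookup f m * Poly_Mapping.lookup g k))"
    by (subst poly_mapping_eq_sum_single[of f], subst poly_mapping_eq_sum_single[of g])
      (simp add: sum_product mult_single)
  then have "eval_poly_at (f * g) x = (\<Sum>m\<in>Poly_Mapping.keys f. \<Sum>k\<in>Poly_Mapping.keys g.
      (Poly_Mapping.lookup f m * (\<Prod>i\<in>Poly_Mapping.keys m. (x $ i) ^ Poly_Mapping.lookup m i)) *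
      (Poly_Mapping.lookup g k * (\<Prod>i\<in>Poly_Mapping.keys k. (x $ i) ^ Poly_Mapping.lookup k i)))"
    by (simp add: eval_poly_at_sum eval_poly_at_single eval_monomial_add mult_ac)
  also have "\<dots> = eval_poly_at f x * eval_poly_at g x"
    by (simp add: eval_poly_at_def sum_product)
  finally show ?thesis .
qed

lemma eval_poly_at_one [simp]: "eval_poly_at 1 x = 1"
  using eval_poly_at_single[of 0 1 x] by simp

lemma eval_poly_at_prod: "eval_poly_at (prod f A) x = (\<Prod>i\<in>A. eval_poly_at (f i) x)"
  by (induction A rule: infinite_finite_induct) (simp_all add: eval_poly_at_mult)

lemma eval_poly_at_power: "eval_poly_at (f ^ n) x = eval_poly_at f x ^ n"
  by (induction n) (simp_all add: eval_poly_at_mult)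

lemma eval_poly_at_poly_var [simp]: "eval_poly_at (poly_var i) x = x $ i"
  by (simp add: poly_var_def eval_poly_at_single)

lemma sum_lookup_eq:
  fixes m :: "nat \<Rightarrow>\<^sub>0 nat"
  assumes "Poly_Mapping.keys m \<subseteq> {..<s}"
  shows "(\<Sum>i\<in>Poly_Mapping.keys m. Poly_Mapping.lookup m i) = (\<Sum>i<s. Poly_Mapping.lookup m i)"
  using assms by (intro sum.mono_neutral_left) (auto simp: in_keys_iff)

lemma homogeneous_part_iff:
  "f \<in> homogeneous_part s d \<longleftrightarrow> (\<forall>m \<in> Poly_Mapping.keys f.
     Poly_Mapping.keys m \<subseteq> {..<s} \<and> (\<Sum>i<s. Poly_Mapping.lookup m i) = d)"
  unfolding homogeneous_part_def by (auto simp: sum_lookup_eq)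

lemma homogeneous_part_add:
  "f \<in> homogeneous_part s d \<Longrightarrow> g \<in> homogeneous_part s d \<Longrightarrow> f + g \<in> homogeneous_part s d"
  unfolding homogeneous_part_iff using Poly_Mapping.keys_add[of f g] by blast

lemma homogeneous_part_mult:
  assumes "f \<in> homogeneous_part s d" "g \<in> homogeneous_part s e"
  shows "f * g \<in> homogeneous_part s (d + e)"
  unfolding homogeneous_part_iff
proof (intro ballI)
  fix m assume "m \<in> Poly_Mapping.keys (f * g)"
  then obtain a b where m: "m = a + b" "a \<in> Poly_Mapping.keys f" "b \<in> Poly_Mapping.keys g"
    using keys_mult[of f g] by blast
  have "Poly_Mapping.keys a \<subseteq> {..<s}" "Poly_Mapping.keys b \<subseteq> {..<s}"
    and "(\<Sum>i<s. Poly_Mapping.lookup a i) = d" "(\<Sum>i<s. Poly_Mapping.lookup b i) = e"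
    using assms m(2,3) unfolding homogeneous_part_iff by blast+
  then show "Poly_Mapping.keys m \<subseteq> {..<s} \<and> (\<Sum>i<s. Poly_Mapping.lookup m i) = d + e"
    using Poly_Mapping.keys_add[of a b] unfolding m(1) by (simp add: lookup_add sum.distrib) blast
qed

lemma homogeneous_part_one: "1 \<in> homogeneous_part s 0"
  unfolding homogeneous_part_iff by simp

lemma homogeneous_part_prod:
  "(\<And>i. i \<in> A \<Longrightarrow> f i \<in> homogeneous_part s (g i)) \<Longrightarrow> prod f A \<in> homogeneous_part s (sum g A)"
  by (induction A rule: infinite_finite_induct)
    (simp_all add: homogeneous_part_one homogeneous_part_mult)

lemma homogeneous_part_power:
  "f \<in> homogeneous_part s d \<Longrightarrow> f ^ n \<in> homogeneous_part s (n * d)"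
  by (induction n) (simp_all add: homogeneous_part_one homogeneous_part_mult)

lemma homogeneous_part_linear:
  "i < s \<Longrightarrow> Poly_Mapping.single (Poly_Mapping.single i 1) a \<in> homogeneous_part s 1"
  unfolding homogeneous_part_iff by (auto simp: lookup_single when_def split: if_splits)

section \<open>Codewords as functions on the affine torus\<close>

text \<open>The affine coordinates of \<open>[p]\<close> on the chart where the coordinate with index \<open>0\<close> is nonzero.\<close>

definition chart :: "nat \<Rightarrow> 'a :: field vec \<Rightarrow> nat \<Rightarrow> 'a" where
  "chart n p = (\<lambda>i\<in>{..<n}. p $ Suc i / p $ 0)"

definition dehomogenized :: "nat \<Rightarrow> 'a :: field mpolynomial \<Rightarrow> (nat \<Rightarrow> 'a) \<Rightarrow> 'a" where
  "dehomogenized n f x = (\<Sum>m\<in>Poly_Mapping.keys f. Poly_Mapping.lookup f m *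
     (\<Prod>i<n. x i ^ Poly_Mapping.lookup m (Suc i)))"

text \<open>Because \<open>f\<close> is homogeneous of degree \<open>d\<close>, dividing by \<open>p\<^sub>0\<^sup>d\<close> distributes one factor \<open>p\<^sub>0\<close> to each
  variable in every monomial.\<close>

lemma eval_quotient_eq_dehomogenized:
  assumes "f \<in> homogeneous_part (Suc n) d" and "p $ 0 \<noteq> 0"
  shows "eval_poly_at f p / eval_poly_at (poly_var 0 ^ d) p = dehomogenized n f (chart n p)"
proof -
  have "(\<Prod>i\<in>Poly_Mapping.keys m. (p $ i) ^ Poly_Mapping.lookup m i) / (p $ 0) ^ d =
      (\<Prod>i<n. chart n p i ^ Poly_Mapping.lookup m (Suc i))"
    if "m \<in> Poly_Mapping.keys f" for m
  proof -
    have m: "Poly_Mapping.keys m \<subseteq> {..<Suc n}" "(\<Sum>i<Suc n. Poly_Mapping.lookup m i) = d"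
      using assms(1) that unfolding homogeneous_part_iff by blast+
    have "(\<Prod>i\<in>Poly_Mapping.keys m. (p $ i) ^ Poly_Mapping.lookup m i) =
        (\<Prod>i<Suc n. (p $ i) ^ Poly_Mapping.lookup m i)"
      using m(1) by (intro prod.mono_neutral_left) (auto simp: in_keys_iff)
    moreover have "(p $ 0) ^ d = (\<Prod>i<Suc n. (p $ 0) ^ Poly_Mapping.lookup m i)"
      unfolding m(2)[symmetric] by (rule power_sum)
    ultimately have "(\<Prod>i\<in>Poly_Mapping.keys m. (p $ i) ^ Poly_Mapping.lookup m i) / (p $ 0) ^ d =
        (\<Prod>i<Suc n. (p $ i / p $ 0) ^ Poly_Mapping.lookup m i)"
      by (simp only: prod_dividef power_divide)
    also have "\<dots> = (\<Prod>i<n. chart n p i ^ Poly_Mapping.lookup m (Suc i))"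
      using assms(2) by (subst prod.lessThan_Suc_shift) (simp add: chart_def)
    finally show ?thesis .
  qed
  then show ?thesis
    by (simp add: eval_poly_at_power dehomogenized_def) (simp add: eval_poly_at_def sum_divide_distrib flip: times_divide_eq_right)
qed

text \<open>Membership of a class in the torus only says that some representative has no zero
  coordinate; all the others are multiples of it.\<close>

lemma representative_nonzero:
  assumes "representatives s (proj_torus s) ps" and "p \<in> set ps"
  shows "p \<in> carrier_vec s" and "i < s \<Longrightarrow> p $ i \<noteq> 0"
proof -
  have p: "p \<in> carrier_vec s - {0\<^sub>v s}" "proj_class s p \<in> proj_torus s"
    using assms by (auto simp: representatives_def)
  then show "p \<in> carrier_vec s" by simp
  obtain x where x: "x \<in> carrier_vec s" "\<forall>i<s. x $ i \<noteq> 0" "proj_class s p = proj_class s x"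
    using p(2) by (auto simp: proj_torus_def)
  have "(x, p) \<in> proj_rel s"
    using x(3) p(1) eq_equiv_class[OF _ equiv_proj_rel, of s x p] by (simp add: proj_class_def)
  then obtain c where "c \<noteq> 0" "x = c \<cdot>\<^sub>v p" "p \<in> carrier_vec s"
    by (auto simp: proj_rel_def)
  then show "p $ i \<noteq> 0" if "i < s" using x(2) that by auto
qed

lemma chart_smult:
  assumes "p \<in> carrier_vec (Suc n)" and "c \<noteq> 0"
  shows "chart n (c \<cdot>\<^sub>v p) = chart n p"
  using assms by (auto simp: chart_def restrict_def)

lemma bij_betw_chart:
  assumes "representatives (Suc n) (proj_torus (Suc n)) ps"
  shows "bij_betw (\<lambda>j. chart n (ps ! j)) {..<length ps} (affine_torus n)"
proof (intro bij_betwI')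
  let ?V = "carrier_vec (Suc n) - {0\<^sub>v (Suc n)} :: 'a vec set"
  have rep: "ps ! j \<in> carrier_vec (Suc n)" "ps ! j \<in> ?V" "\<And>i. i < Suc n \<Longrightarrow> ps ! j $ i \<noteq> 0"
    if "j < length ps" for j
    using representative_nonzero[OF assms nth_mem[OF that]] assms nth_mem[OF that]
    by (auto simp: representatives_def)
  fix j k assume j: "j \<in> {..<length ps}" and k: "k \<in> {..<length ps}"
  show "chart n (ps ! j) = chart n (ps ! k) \<longleftrightarrow> j = k"
  proof
    assume eq: "chart n (ps ! j) = chart n (ps ! k)"
    define p q where "p = ps ! j" and "q = ps ! k"
    have pq: "p \<in> ?V" "q \<in> ?V" "p $ 0 \<noteq> 0" "q $ 0 \<noteq> 0" "p \<in> carrier_vec (Suc n)" "q \<in> carrier_vec (Suc n)"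
      using rep j k by (auto simp: p_def q_def)
    have "p $ i / p $ 0 = q $ i / q $ 0" if "i < Suc n" for i
      using fun_cong[OF eq, of "i - 1"] that pq by (cases i) (simp_all add: chart_def p_def q_def)
    then have "p = (p $ 0 / q $ 0) \<cdot>\<^sub>v q"
      using pq by (intro eq_vecI) (auto simp: field_simps)
    then have "(p, q) \<in> proj_rel (Suc n)"
      unfolding proj_rel_def using pq by (auto intro!: exI[of _ "p $ 0 / q $ 0"])
    then have "map (proj_class (Suc n)) ps ! j = map (proj_class (Suc n)) ps ! k"
      using j k equiv_class_eq[OF equiv_proj_rel] by (simp add: proj_class_def p_def q_def)
    then show "j = k"
      using j k assms nth_eq_iff_index_eq[of "map (proj_class (Suc n)) ps"]
      by (simp add: representatives_def)
  qed simp
next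
  fix j assume j: "j \<in> {..<length ps}"
  then show "chart n (ps ! j) \<in> affine_torus n"
    using representative_nonzero(2)[OF assms nth_mem, of j] by (auto simp: chart_def affine_torus_def)
next
  fix y :: "nat \<Rightarrow> 'a" assume y: "y \<in> affine_torus n"
  define x where "x = vec (Suc n) (\<lambda>i. if i = 0 then 1 else y (i - 1))"
  have x: "x \<in> carrier_vec (Suc n)" "\<forall>i<Suc n. x $ i \<noteq> 0" 
    using y by (auto simp: x_def affine_torus_def PiE_def Pi_def)
  have x0: "x \<noteq> 0\<^sub>v (Suc n)" using x(2) by force
  have "proj_class (Suc n) x \<in> proj_torus (Suc n)"
    using x x0 by (auto simp: proj_torus_def proj_space_def proj_class_def intro!: quotientI)
  then have "proj_class (Suc n) x \<in> set (map (proj_class (Suc n)) ps)"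
    using assms by (simp only: representatives_def)
  then obtain j where j: "j < length ps" "proj_class (Suc n) (ps ! j) = proj_class (Suc n) x"
    unfolding in_set_conv_nth by auto
  have "(ps ! j, x) \<in> proj_rel (Suc n)"
    using j(2) x(1) x0 eq_equiv_class[OF _ equiv_proj_rel, of "Suc n" "ps ! j" x]
    by (simp add: proj_class_def)
  then obtain c where c: "c \<noteq> 0" "ps ! j = c \<cdot>\<^sub>v x"
    by (auto simp: proj_rel_def)
  have "y = chart n x"
    using y by (auto simp: chart_def x_def affine_torus_def PiE_def extensional_def restrict_def)
  then have "y = chart n (ps ! j)"
    using c chart_smult[OF x(1)] by simp
  then show "\<exists>j\<in>{..<length ps}. y = chart n (ps ! j)" using j(1) by blast
qed

lemma hamming_weight_ev:
  assumes "representatives (Suc n) (proj_torus (Suc n)) ps" and "f \<in> homogeneous_part (Suc n) d"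
  shows "hamming_weight (ev d ps f) = card {x \<in> affine_torus n. dehomogenized n f x \<noteq> 0}"
proof -
  define \<phi> where "\<phi> j = chart n (ps ! j)" for j
  have bij: "bij_betw \<phi> {..<length ps} (affine_torus n)"
    unfolding \<phi>_def by (rule bij_betw_chart[OF assms(1)])
  have entry: "ev d ps f $ j = dehomogenized n f (\<phi> j)" if "j < length ps" for j
    using eval_quotient_eq_dehomogenized[OF assms(2)] representative_nonzero[OF assms(1) nth_mem[OF that]] that
    by (simp add: ev_def \<phi>_def vec_of_list_index)
  have dim: "dim_vec (ev d ps f) = length ps" by (simp add: ev_def)
  let ?J = "{j \<in> {..<length ps}. dehomogenized n f (\<phi> j) \<noteq> 0}"
  have "hamming_weight (ev d ps f) = card ?J"
    unfolding hamming_weight_def dim by (rule arg_cong[of _ _ card]) (auto simp: entry)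
  also have "\<dots> = card (\<phi> ` ?J)"
    using bij by (intro card_image[symmetric]) (auto simp: bij_betw_def inj_on_def)
  also have "\<phi> ` ?J = {x \<in> affine_torus n. dehomogenized n f x \<noteq> 0}"
    using bij by (auto simp: bij_betw_def)
  finally show ?thesis .
qed

text \<open>The form is a product of linear factors \<open>t\<^bsub>i+1\<^esub> - a t\<^sub>0\<close> (variables
  indexed from \<open>0\<close>) with \<open>a\<close> in a set \<open>A\<^sub>i\<close> of \<open>r\<^sub>i\<close> units.  On
  the affine torus it is nonzero exactly where every coordinate avoids its set \<open>A\<^sub>i\<close>, which is a
  box of the required size.\<close>

lemma exists_form_with_weight:
  fixes ps :: "'a :: {field, finite} vec list"
  assumes rep: "representatives (Suc n) (proj_torus (Suc n)) ps"
    and r: "\<And>i. i < n \<Longrightarrow> r i \<le> CARD('a) - 1" "(\<Sum>i<n. r i) \<le> d"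
  shows "\<exists>f \<in> homogeneous_part (Suc n) d.
    hamming_weight (ev d ps f) = (\<Prod>i<n. CARD('a) - 1 - r i)"
proof -
  have "\<exists>A. A \<subseteq> - {0 :: 'a} \<and> card A = r i" if "i < n" for i
    using r(1)[OF that] obtain_subset_with_card_n[of "r i" "- {0 :: 'a}"]
    by (metis card_units)
  then obtain A :: "nat \<Rightarrow> 'a set" where A: "\<And>i. i < n \<Longrightarrow> A i \<subseteq> - {0}" "\<And>i. i < n \<Longrightarrow> card (A i) = r i"
    by metis
  define lin :: "nat \<Rightarrow> 'a \<Rightarrow> 'a mpolynomial" where
    "lin i a = poly_var (Suc i) + Poly_Mapping.single (Poly_Mapping.single 0 1) (- a)" for i a
  define f where "f = poly_var 0 ^ (d - (\<Sum>i<n. r i)) * (\<Prod>i<n. \<Prod>a\<in>A i. lin i a)"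
  have lin: "lin i a \<in> homogeneous_part (Suc n) 1" if "i < n" for i a
    unfolding lin_def poly_var_def using that
    by (intro homogeneous_part_add homogeneous_part_linear) auto
  have "(\<Prod>a\<in>A i. lin i a) \<in> homogeneous_part (Suc n) (r i)" if "i < n" for i
    using homogeneous_part_prod[of "A i" "lin i" "Suc n" "\<lambda>_. 1"] lin[OF that] A(2)[OF that] by simp
  then have "(\<Prod>i<n. \<Prod>a\<in>A i. lin i a) \<in> homogeneous_part (Suc n) (\<Sum>i<n. r i)"
    by (intro homogeneous_part_prod) simp
  moreover have "poly_var 0 ^ (d - (\<Sum>i<n. r i)) \<in> homogeneous_part (Suc n) ((d - (\<Sum>i<n. r i)) * 1)"
    unfolding poly_var_def by (intro homogeneous_part_power homogeneous_part_linear) simp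
  ultimately have "f \<in> homogeneous_part (Suc n) ((d - (\<Sum>i<n. r i)) * 1 + (\<Sum>i<n. r i))"
    unfolding f_def by (intro homogeneous_part_mult)
  then have f: "f \<in> homogeneous_part (Suc n) d" using r(2) by simp
  have val: "dehomogenized n f x = (\<Prod>i<n. \<Prod>a\<in>A i. x i - a)" if "x \<in> affine_torus n" for x
  proof -
    define p where "p = vec (Suc n) (\<lambda>i. if i = 0 then 1 else x (i - 1))"
    have "x = chart n p"
      using that by (auto simp: chart_def p_def affine_torus_def PiE_def extensional_def restrict_def)
    then have "dehomogenized n f x = eval_poly_at f p"
      using eval_quotient_eq_dehomogenized[OF f, of p] by (simp add: eval_poly_at_power p_def)
    also have "\<dots> = (\<Prod>i<n. \<Prod>a\<in>A i. x i - a)"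
      by (simp add: f_def eval_poly_at_mult eval_poly_at_power eval_poly_at_prod lin_def
          eval_poly_at_add eval_poly_at_single p_def)
    finally show ?thesis .
  qed
  have "{x \<in> affine_torus n. dehomogenized n f x \<noteq> 0} = (\<Pi>\<^sub>E i\<in>{..<n}. - {0} - A i)"
  proof (rule Set.set_eqI)
    fix x :: "nat \<Rightarrow> 'a"
    have "x \<in> affine_torus n \<and> (\<forall>i<n. \<forall>a\<in>A i. x i \<noteq> a) \<longleftrightarrow> x \<in> (\<Pi>\<^sub>E i\<in>{..<n}. - {0} - A i)"
      by (auto simp: affine_torus_def PiE_iff)
    then show "x \<in> {x \<in> affine_torus n. dehomogenized n f x \<noteq> 0} \<longleftrightarrow> x \<in> (\<Pi>\<^sub>E i\<in>{..<n}. - {0} - A i)"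
      using val[of x] by auto
  qed
  then have "hamming_weight (ev d ps f) = (\<Prod>i<n. card (- {0} - A i))"
    by (simp add: hamming_weight_ev[OF rep f] card_PiE)
  also have "\<dots> = (\<Prod>i<n. CARD('a) - 1 - r i)"
    using A by (intro prod.cong) (simp_all add: card_Diff_subset card_units)
  finally show ?thesis using f by blast
qed

lemma weight_ge_prod:
  fixes ps :: "'a :: {field, finite} vec list"
  assumes "representatives (Suc n) (proj_torus (Suc n)) ps"
    and "f \<in> homogeneous_part (Suc n) d" and "0 < hamming_weight (ev d ps f)"
  shows "\<exists>r. (\<forall>i<n. r i < CARD('a) - 1) \<and> (\<Sum>i<n. r i) \<le> d \<and>
    (\<Prod>i<n. CARD('a) - 1 - r i) \<le> hamming_weight (ev d ps f)"
proof -
  have wt: "hamming_weight (ev d ps f) = card {x \<in> affine_torus n. dehomogenized n f x \<noteq> 0}"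
    by (rule hamming_weight_ev[OF assms(1,2)])
  have "\<exists>x \<in> affine_torus n. dehomogenized n f x \<noteq> 0"
    using assms(3) unfolding wt by (auto simp: card_gt_0_iff)
  moreover have "(\<Sum>i<n. Poly_Mapping.lookup m (Suc i)) \<le> d" if "m \<in> Poly_Mapping.keys f" for m
  proof -
    have "(\<Sum>i<Suc n. Poly_Mapping.lookup m i) = d"
      using assms(2) that unfolding homogeneous_part_iff by blast
    then show ?thesis unfolding sum.lessThan_Suc_shift by simp
  qed
  ultimately show ?thesis
    unfolding wt dehomogenized_def by (intro card_torus_nonzeros_ge) simp_all
qed

lemma hamming_weight_pos_iff:
  "0 < hamming_weight v \<longleftrightarrow> v \<noteq> 0\<^sub>v (dim_vec v)"
proof -
  have "0 < hamming_weight v \<longleftrightarrow> (\<exists>i<dim_vec v. v $ i \<noteq> 0)"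
    by (auto simp: hamming_weight_def card_gt_0_iff)
  also have "\<dots> \<longleftrightarrow> v \<noteq> 0\<^sub>v (dim_vec v)"
    by (auto simp: vec_eq_iff)
  finally show ?thesis .
qed

lemma min_distance_eqI:
  fixes ps :: "'a :: {field, finite} vec list"
  assumes len: "length ps = N"
    and f: "f \<in> homogeneous_part s d" "hamming_weight (ev d ps f) = w" "0 < w"
    and le: "\<And>g. g \<in> homogeneous_part s d \<Longrightarrow> 0 < hamming_weight (ev d ps g) \<Longrightarrow>
      w \<le> hamming_weight (ev d ps g)"
  shows "min_distance N (eval_code s d ps) = w"
  unfolding min_distance_def
proof (rule Min_eqI)
  have dim: "dim_vec (ev d ps g) = N" for g by (simp add: ev_def len)
  have "hamming_weight (ev d ps g) \<le> N" for g
    using card_mono[of "{..<N}" "{i. i < N \<and> ev d ps g $ i \<noteq> 0}"]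
    by (auto simp: hamming_weight_def dim)
  then have "hamming_weight ` (eval_code s d ps - {0\<^sub>v N}) \<subseteq> {..N}"
    by (auto simp: eval_code_def)
  then show "finite (hamming_weight ` (eval_code s d ps - {0\<^sub>v N}))"
    by (rule finite_subset) simp
  have nz: "0 < hamming_weight (ev d ps g) \<longleftrightarrow> ev d ps g \<noteq> 0\<^sub>v N" for g
    by (simp add: hamming_weight_pos_iff dim)
  show "w \<le> y" if "y \<in> hamming_weight ` (eval_code s d ps - {0\<^sub>v N})" for y
    using that le nz by (auto simp: eval_code_def)
  show "w \<in> hamming_weight ` (eval_code s d ps - {0\<^sub>v N})"
    using f nz[of f] by (force simp: eval_code_def)
qed

section \<open>The minimum distance\<close>

text \<open>The choice of \<open>r\<close> for which \<open>prod_gap_ge\<close> is an equality.\<close>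

lemma prod_gap_extremal:
  fixes M :: nat
  assumes "k < n"
  shows "(\<Sum>i<n. if i < k then M else if i = k then l else 0) = k * M + l"
    and "(\<Prod>i<n. M + 1 - (if i < k then M else if i = k then l else 0)) =
      (M + 1) ^ (n - 1 - k) * (M + 1 - l)"
proof -
  have n: "{..<n} = {..<k} \<union> {k} \<union> {Suc k..<n}" using assms by auto
  show "(\<Sum>i<n. if i < k then M else if i = k then l else 0) = k * M + l"
    unfolding n by (subst sum.union_disjoint; (subst sum.union_disjoint)?) auto
  show "(\<Prod>i<n. M + 1 - (if i < k then M else if i = k then l else 0)) =
      (M + 1) ^ (n - 1 - k) * (M + 1 - l)"
    unfolding n by (subst prod.union_disjoint; (subst prod.union_disjoint)?) auto
qed

theorem theorem3p5:
  fixes ps :: "'a :: {field, finite} vec list" and X :: "'a vec set set" and q s d :: nat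
  assumes "q = CARD('a)"
    and "s \<ge> 1"
    and "X = proj_torus s"
    and "representatives s X ps"
    and "d \<ge> 1"
  shows "(int d \<le> (int q - 2) * (int s - 1) - 1 \<longrightarrow>
            (\<exists>!(k, l). 1 \<le> l \<and> l \<le> q - 2 \<and> d = k * (q - 2) + l) \<and>
            (\<forall>k l. 1 \<le> l \<and> l \<le> q - 2 \<and> d = k * (q - 2) + l \<longrightarrow>
               int (min_distance (card X) (eval_code s d ps)) =
                 (int q - 1) ^ (s - (k + 2)) * (int q - 1 - int l))) \<and>
         (int d \<ge> (int q - 2) * (int s - 1) \<longrightarrow>
            min_distance (card X) (eval_code s d ps) = 1)"
proof -
  obtain n where s: "s = Suc n" using assms(2) by (cases s) auto
  have rep: "representatives (Suc n) (proj_torus (Suc n)) ps" using assms(3,4) s by simp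
  have len: "length ps = card X"
    using assms(4) distinct_card[of "map (proj_class s) ps"] by (simp add: representatives_def)
  have "2 \<le> q"
    unfolding assms(1) using card_mono[of UNIV "{0, 1 :: 'a}"] by simp
  then obtain M where M: "q = M + 2" using le_Suc_ex by (metis add.commute)
  have card: "CARD('a) - 1 = M + 1" using M assms(1) by simp
  have bound: "(int q - 2) * (int s - 1) = int (M * n)" by (simp add: M s)
  have first: "int (min_distance (card X) (eval_code s d ps)) =
      (int q - 1) ^ (s - (k + 2)) * (int q - 1 - int l)"
    if d: "d < M * n" and l: "1 \<le> l" "l \<le> M" "d = k * M + l" for k l
  proof -
    have "k * M < n * M" using d l(3) unfolding mult.commute[of M n] by linarith
    then have k: "k < n" by (simp only: mult_less_cancel2)
    let ?r = "\<lambda>i. if i < k then M else if i = k then l else 0"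
    let ?w = "(M + 1) ^ (n - 1 - k) * (M + 1 - l)"
    have "(\<Sum>i<n. ?r i) \<le> d" using prod_gap_extremal(1)[OF k, of M l] l(3) by simp
    moreover have "?r i \<le> CARD('a) - 1" for i using l(2) card by simp
    ultimately obtain f where f: "f \<in> homogeneous_part s d" "hamming_weight (ev d ps f) = ?w"
      using exists_form_with_weight[OF rep, of ?r d] prod_gap_extremal(2)[OF k, of M l]
      unfolding card s by auto
    have "min_distance (card X) (eval_code s d ps) = ?w"
    proof (rule min_distance_eqI[OF len f])
      show "0 < ?w" using l by simp
      fix g assume g: "g \<in> homogeneous_part s d" "0 < hamming_weight (ev d ps g)"
      obtain r where "\<forall>i<n. r i < M + 1" "(\<Sum>i<n. r i) \<le> d"
        "(\<Prod>i<n. M + 1 - r i) \<le> hamming_weight (ev d ps g)"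
        using weight_ge_prod[OF rep _ g(2)] g(1) unfolding card s by blast
      then show "?w \<le> hamming_weight (ev d ps g)"
        using prod_gap_ge[of n r M k l] k l by (auto simp: less_Suc_eq_le)
    qed
    moreover have "s - (k + 2) = n - 1 - k" by (simp add: s)
    ultimately show ?thesis using l(2) by (simp add: M of_nat_diff)
  qed
  have second: "min_distance (card X) (eval_code s d ps) = 1" if "M * n \<le> d"
  proof -
    have "(\<Sum>i<n. M) \<le> d" using that by (simp add: mult.commute)
    then obtain f where f: "f \<in> homogeneous_part s d" "hamming_weight (ev d ps f) = 1"
      using exists_form_with_weight[OF rep, of "\<lambda>_. M" d] unfolding card s by auto
    show ?thesis by (rule min_distance_eqI[OF len f]) auto
  qed
  have unique: "\<exists>!(k, l). 1 \<le> l \<and> l \<le> M \<and> d = k * M + l" if "d < M * n"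
  proof -
    have "0 < M" using that by (cases M) auto
    show ?thesis
    (* The remainder runs through 1, ..., M instead of 0, ..., M - 1, so d - 1 is divided. *)
    proof (rule ex1I[of _ "((d - 1) div M, (d - 1) mod M + 1)"], goal_cases)
      case 1
      have "d = (d - 1) div M * M + ((d - 1) mod M + 1)" using assms(5) by simp
      then show ?case using \<open>0 < M\<close> by (simp add: Suc_le_eq)
    next
      case (2 kl)
      obtain k l where kl: "kl = (k, l)" by fastforce
      with 2 have l: "1 \<le> l" "l \<le> M" "d = k * M + l" by auto
      obtain l' where l': "l = Suc l'" using l(1) by (cases l) auto
      have "d - 1 = l' + k * M" "l' < M" using l l' by auto
      then show ?case by (simp add: kl l')
    qed
  qed
  have less: "int d \<le> int (M * n) - 1 \<longleftrightarrow> d < M * n" by linarith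
  show ?thesis
    unfolding bound less of_nat_le_iff using first second unique by (simp add: M)
qed

end
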